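(* Let $m\geqslant 3$, $n\geqslant 3$ be odd integers, $m=2m_0+1$, $n=2n_0+1$, $m_0^{+}=m_0+1$, $n_0^{+}=n_0+1$. Let $X$ be a bicentrally balanced $C_4$-face-magic projective labeling on $\mathcal{P}_{m,n}$. Then there is a unique bicentrally balanced $C_4$-face-magic projective labeling $Z=\{z_{i,j}\}$ on $\mathcal{P}_{m,n}$ that is projective labeling equivalent to $X$ such that: $z_{i,n_0^{+}}<z_{i+2,n_0^{+}}$ for all $1\leqslant i\leqslant m-2$ with $i+n_0^{+}$ even; $z_{i,n_0^{+}}>z_{i+2,n_0^{+}}$ for all $1\leqslant i\leqslant m-2$ with $i+n_0^{+}$ odd; $z_{m_0^{+},j}<z_{m_0^{+},j+2}$ for all $1\leqslant j\leqslant n-2$ with $m_0^{+}+j$ even; and $z_{m_0^{+},j}>z_{m_0^{+},j+2}$ for all $1\leqslant j\leqslant n-2$ with $m_0^{+}+j$ odd.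
   Context: For integers $m,n\geqslant 2$, the projective grid graph $\mathcal{P}_{m,n}$ has vertex set $\{(i,j):1\leqslant i\leqslant m,\ 1\leqslant j\leqslant n\}$ and edges $(i,j)$–$(i,j+1)$ ($j\leqslant n-1$), $(i,n)$–$(m+1-i,1)$, $(i,j)$–$(i+1,j)$ ($i\leqslant m-1$), $(m,j)$–$(1,n+1-j)$, embedded naturally in the projective plane. Its 4-cycle faces are $\{(i,j),(i+1,j),(i,j+1),(i+1,j+1)\}$ ($1\leqslant i\leqslant m-1$, $1\leqslant j\leqslant n-1$), $\{(i,n),(i+1,n),(m+1-i,1),(m-i,1)\}$ ($1\leqslant i\leqslant m-1$), and $\{(m,j),(m,j+1),(1,n+1-j),(1,n-j)\}$ ($1\leqslant j\leqslant n-1$); the other two faces are digons. A $C_4$-face-magic projective labeling is a bijection $(i,j)\mapsto x_{i,j}$ onto $\{1,\ldots,mn\}$ such that every 4-cycle face has the same label sum (the $C_4$-face-magic value). For odd $m,n$ let $S(i,j)=\tfrac12 mn+\tfrac32$ if $i+j$ is even and $\tfrac32 mn+\tfrac32$ if $i+j$ is odd; a $C_4$-face-magic projective labeling with value $2mn+3$ is bicentrally balanced if $x_{i,j}+x_{m+1-i,n+1-j}=S(i,j)$ for all $(i,j)$. Elementary projective labeling operations on a bicentrally balanced labeling $X=\{x_{i,j}\}$ (each producing $Z=\{z_{i,j}\}$) are: (a) for a permutation $\eta$ of $\{1,\ldots,m_0\}$ with $\eta(i)\equiv i\pmod 2$: $z_{i,j}=x_{\eta(i),j}$, $z_{m_0^{+},j}=x_{m_0^{+},j}$,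 $z_{m+1-i,j}=x_{m+1-\eta(i),j}$ ($1\leqslant i\leqslant m_0$, $1\leqslant j\leqslant n$); (b) for a permutation $\kappa$ of $\{1,\ldots,n_0\}$ with $\kappa(j)\equiv j\pmod 2$: $z_{i,j}=x_{i,\kappa(j)}$, $z_{i,n_0^{+}}=x_{i,n_0^{+}}$, $z_{i,n+1-j}=x_{i,n+1-\kappa(j)}$ ($1\leqslant i\leqslant m$, $1\leqslant j\leqslant n_0$); (c) for $\alpha:\{1,\ldots,m_0\}\to\{0,1\}$: swap the labels of column $i$ (vertices $(i,\cdot)$) with those of column $m+1-i$ exactly when $\alpha(i)=1$, other labels unchanged; (d) for $\delta:\{1,\ldots,n_0\}\to\{0,1\}$: swap the labels of row $j$ (vertices $(\cdot,j)$) with those of row $n+1-j$ exactly when $\delta(j)=1$, other labels unchanged. Each such operation sends bicentrally balanced $C_4$-face-magic projective labelings to bicentrally balanced $C_4$-face-magic projective labelings. Two bicentrally balanced $C_4$-face-magic projective labelings are projective labeling equivalent if one can be obtained from the other by a finite sequence of elementary projective labeling operations. *)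

theory Defs
  imports Complex_Main "HOL-Library.FuncSet" "HOL-Combinatorics.Permutations"
begin

definition grid :: "nat \<Rightarrow> nat \<Rightarrow> (nat \<times> nat) set" where
  "grid m n = {1..m} \<times> {1..n}"

text \<open>
  The 4-cycle faces of the naturally embedded projective grid graph, as vertex sets. The two
  remaining faces are digons and impose no condition. For \<open>m, n \<ge> 2\<close> the four listed
  vertices are pairwise distinct, so summing over the vertex set is summing over the 4-cycle.
\<close>

definition C4_faces :: "nat \<Rightarrow> nat \<Rightarrow> (nat \<times> nat) set set" where
  "C4_faces m n =
     {{(i, j), (i + 1, j), (i, j + 1), (i + 1, j + 1)} | i j. i \<in> {1..m - 1} \<and> j \<in> {1..n - 1}}
   \<union> {{(i, n), (i + 1, n), (m + 1 - i, 1), (m - i, 1)} | i. i \<in> {1..m - 1}}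
   \<union> {{(m, j), (m, j + 1), (1, n + 1 - j), (1, n - j)} | j. j \<in> {1..n - 1}}"

text \<open>
  A labeling is a function on the vertices only; membership in \<^term>\<open>extensional (grid m n)\<close>
  makes its values off the grid irrelevant, so that HOL equality is equality of labelings.
\<close>

definition C4_face_magic :: "nat \<Rightarrow> nat \<Rightarrow> (nat \<times> nat \<Rightarrow> nat) \<Rightarrow> nat \<Rightarrow> bool" where
  "C4_face_magic m n x c \<longleftrightarrow>
     x \<in> extensional (grid m n) \<and> bij_betw x (grid m n) {1..m * n} \<and>
     (\<forall>F\<in>C4_faces m n. (\<Sum>v\<in>F. x v) = c)"

definition balance_sum :: "nat \<Rightarrow> nat \<Rightarrow> nat \<Rightarrow> nat \<Rightarrow> real" where
  "balance_sum m n i j =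
     (if even (i + j) then 1 / 2 * real (m * n) + 3 / 2 else 3 / 2 * real (m * n) + 3 / 2)"

definition bicentrally_balanced :: "nat \<Rightarrow> nat \<Rightarrow> (nat \<times> nat \<Rightarrow> nat) \<Rightarrow> bool" where
  "bicentrally_balanced m n x \<longleftrightarrow>
     C4_face_magic m n x (2 * m * n + 3) \<and>
     (\<forall>i\<in>{1..m}. \<forall>j\<in>{1..n}.
        real (x (i, j)) + real (x (m + 1 - i, n + 1 - j)) = balance_sum m n i j)"

text \<open>
  The elementary operations, for \<open>m = 2 * m0 + 1\<close> and \<open>n = 2 * n0 + 1\<close>, so that
  \<open>m0 = m div 2\<close> and \<open>n0 = n div 2\<close>. Each relation prescribes the values of \<open>z\<close> on the grid.
\<close>

definition column_perm_op ::
  "nat \<Rightarrow> nat \<Rightarrow> (nat \<times> nat \<Rightarrow> nat) \<Rightarrow> (nat \<times> nat \<Rightarrow> nat) \<Rightarrow> bool" where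
  "column_perm_op m n x z \<longleftrightarrow>
     (\<exists>\<eta>. \<eta> permutes {1..m div 2} \<and> (\<forall>i\<in>{1..m div 2}. \<eta> i mod 2 = i mod 2) \<and>
       (\<forall>j\<in>{1..n}. z (m div 2 + 1, j) = x (m div 2 + 1, j) \<and>
         (\<forall>i\<in>{1..m div 2}. z (i, j) = x (\<eta> i, j) \<and>
                            z (m + 1 - i, j) = x (m + 1 - \<eta> i, j))))"

definition row_perm_op ::
  "nat \<Rightarrow> nat \<Rightarrow> (nat \<times> nat \<Rightarrow> nat) \<Rightarrow> (nat \<times> nat \<Rightarrow> nat) \<Rightarrow> bool" where
  "row_perm_op m n x z \<longleftrightarrow>
     (\<exists>\<kappa>. \<kappa> permutes {1..n div 2} \<and> (\<forall>j\<in>{1..n div 2}. \<kappa> j mod 2 = j mod 2) \<and>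
       (\<forall>i\<in>{1..m}. z (i, n div 2 + 1) = x (i, n div 2 + 1) \<and>
         (\<forall>j\<in>{1..n div 2}. z (i, j) = x (i, \<kappa> j) \<and>
                            z (i, n + 1 - j) = x (i, n + 1 - \<kappa> j))))"

definition column_swap_op ::
  "nat \<Rightarrow> nat \<Rightarrow> (nat \<times> nat \<Rightarrow> nat) \<Rightarrow> (nat \<times> nat \<Rightarrow> nat) \<Rightarrow> bool" where
  "column_swap_op m n x z \<longleftrightarrow>
     (\<exists>\<alpha> :: nat \<Rightarrow> nat. \<alpha> \<in> {1..m div 2} \<rightarrow> {0, 1} \<and>
       (\<forall>j\<in>{1..n}. z (m div 2 + 1, j) = x (m div 2 + 1, j) \<and>
         (\<forall>i\<in>{1..m div 2}.
            z (i, j) = (if \<alpha> i = 1 then x (m + 1 - i, j) else x (i, j)) \<and>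
            z (m + 1 - i, j) = (if \<alpha> i = 1 then x (i, j) else x (m + 1 - i, j)))))"

definition row_swap_op ::
  "nat \<Rightarrow> nat \<Rightarrow> (nat \<times> nat \<Rightarrow> nat) \<Rightarrow> (nat \<times> nat \<Rightarrow> nat) \<Rightarrow> bool" where
  "row_swap_op m n x z \<longleftrightarrow>
     (\<exists>\<delta> :: nat \<Rightarrow> nat. \<delta> \<in> {1..n div 2} \<rightarrow> {0, 1} \<and>
       (\<forall>i\<in>{1..m}. z (i, n div 2 + 1) = x (i, n div 2 + 1) \<and>
         (\<forall>j\<in>{1..n div 2}.
            z (i, j) = (if \<delta> j = 1 then x (i, n + 1 - j) else x (i, j)) \<and>
            z (i, n + 1 - j) = (if \<delta> j = 1 then x (i, j) else x (i, n + 1 - j)))))"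

definition elementary_op ::
  "nat \<Rightarrow> nat \<Rightarrow> (nat \<times> nat \<Rightarrow> nat) \<Rightarrow> (nat \<times> nat \<Rightarrow> nat) \<Rightarrow> bool" where
  "elementary_op m n x z \<longleftrightarrow>
     bicentrally_balanced m n x \<and> z \<in> extensional (grid m n) \<and>
     (column_perm_op m n x z \<or> row_perm_op m n x z \<or>
      column_swap_op m n x z \<or> row_swap_op m n x z)"

definition projective_labeling_equivalent ::
  "nat \<Rightarrow> nat \<Rightarrow> (nat \<times> nat \<Rightarrow> nat) \<Rightarrow> (nat \<times> nat \<Rightarrow> nat) \<Rightarrow> bool" where
  "projective_labeling_equivalent m n x z \<longleftrightarrow>
     bicentrally_balanced m n x \<and> bicentrally_balanced m n z \<and>
     ((elementary_op m n)\<^sup>*\<^sup>* x z \<or> (elementary_op m n)\<^sup>*\<^sup>* z x)"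

end

theory Submission imports Defs begin

text \<open>
  Every elementary operation relabels \<open>x\<close> as \<open>(i, j) \<mapsto> x (\<sigma> i, \<tau> j)\<close>, where \<open>\<sigma>\<close> and \<open>\<tau>\<close> are
  permutations that preserve parity and commute with the reflections \<open>i \<mapsto> m + 1 - i\<close> and
  \<open>j \<mapsto> n + 1 - j\<close>; conversely every such relabeling is a composition of elementary operations. Since
  \<open>\<sigma>\<close> and \<open>\<tau>\<close> fix the two central lines, the required order concerns \<open>\<sigma>\<close> through the labels
  \<open>x (i, n0 + 1)\<close> alone, and \<open>\<tau>\<close> through \<open>x (m0 + 1, j)\<close> alone: on each parity class the
  permutation must sort these labels. There is exactly one such sorting permutation. By balance,
  reflection reverses the order of the labels in a parity class, so conjugating the sorting
  permutation by reflection sorts as well, and uniqueness makes the two commute.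
\<close>

section \<open>Sorting permutations\<close>

lemma strict_mono_on_image_eq_imp_eq:
  fixes f g :: "'a::linorder \<Rightarrow> 'b::linorder"
  assumes "finite A" "strict_mono_on A f" "strict_mono_on A g" "f ` A = g ` A" "x \<in> A"
  shows "f x = g x"
proof -
  define xs where "xs = sorted_list_of_set A"
  have xs: "set xs = A" "sorted_wrt (<) xs"
    using assms(1) by (simp_all add: xs_def)
  have "sorted_wrt (<) (map h xs)" if "strict_mono_on A h" for h :: "'a \<Rightarrow> 'b"
    using xs that by (intro sorted_wrt_map_mono[OF xs(2)]) (auto simp: monotone_on_def)
  then have "map f xs = map g xs"
    using assms(2-4) xs(1) by (intro strict_sorted_equal) simp_all
  then show ?thesis
    using assms(5) xs(1) by simp
qed

lemma strict_mono_on_nth_sorted_list_of_set: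
  fixes S :: "'a::linorder set"
  assumes "finite S"
  shows "strict_mono_on {..<card S} ((!) (sorted_list_of_set S))"
  using assms by (auto intro!: strict_mono_onI sorted_wrt_nth_less[of "(<)"])

lemma obtain_strict_mono_bij_betw:
  fixes A :: "'a::linorder set" and B :: "'b::linorder set"
  assumes "finite A" "finite B" "card A = card B"
  obtains h where "bij_betw h A B" "strict_mono_on A h"
proof -
  define xs ys where "xs = sorted_list_of_set A" and "ys = sorted_list_of_set B"
  define I where "I = {..<card A}"
  have xs: "bij_betw ((!) xs) I A" and ys: "bij_betw ((!) ys) I B"
    using assms by (auto intro!: bij_betw_nth simp: xs_def ys_def I_def)
  have mono: "strict_mono_on I ((!) xs)" "strict_mono_on I ((!) ys)"
    using strict_mono_on_nth_sorted_list_of_set assms unfolding xs_def ys_def I_def by metis+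
  define index where "index = the_inv_into I ((!) xs)"
  have index: "index x \<in> I" "xs ! index x = x" if "x \<in> A" for x
    using that xs by (auto simp: index_def bij_betw_def the_inv_into_into f_the_inv_into_f)
  show thesis
  proof
    show "bij_betw ((!) ys \<circ> index) A B"
      using bij_betw_the_inv_into[OF xs] ys unfolding index_def by (rule bij_betw_trans)
    show "strict_mono_on A ((!) ys \<circ> index)"
    proof (rule strict_mono_onI)
      fix x y assume xy: "x \<in> A" "y \<in> A" "x < y"
      then have "index x < index y"
        using index strict_mono_on_less[OF mono(1)] by metis
      then show "((!) ys \<circ> index) x < ((!) ys \<circ> index) y"
        using index xy strict_mono_onD[OF mono(2)] by simp
    qed
  qed
qed

definition fibre :: "('a \<Rightarrow> 'b) \<Rightarrow> 'a set \<Rightarrow> 'b \<Rightarrow> 'a set" where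
  "fibre c A k = {x \<in> A. c x = k}"

definition fibrewise_sorts ::
  "('a::order \<Rightarrow> 'b) \<Rightarrow> 'a set \<Rightarrow> ('a \<Rightarrow> 'c::order) \<Rightarrow> ('a \<Rightarrow> 'a) \<Rightarrow> bool" where
  "fibrewise_sorts c A g \<sigma> \<longleftrightarrow>
     \<sigma> permutes A \<and> (\<forall>x. c (\<sigma> x) = c x) \<and> (\<forall>k. strict_mono_on (fibre c A k) (g \<circ> \<sigma>))"

lemma permutes_image_fibre:
  assumes "\<sigma> permutes A" "\<And>x. c (\<sigma> x) = c x"
  shows "\<sigma> ` fibre c A k = fibre c A k"
proof
  show "fibre c A k \<subseteq> \<sigma> ` fibre c A k"
  proof
    fix y assume y: "y \<in> fibre c A k"
    then have "inv \<sigma> y \<in> fibre c A k"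
      using permutes_in_image[OF permutes_inv[OF assms(1)]]
        permutes_inverses(1)[OF assms(1)] assms(2)
      unfolding fibre_def by (metis (mono_tags, lifting) mem_Collect_eq)
    then show "y \<in> \<sigma> ` fibre c A k"
      using permutes_inverses(1)[OF assms(1)] by (metis imageI)
  qed
qed (use assms permutes_in_image[OF assms(1)] in \<open>auto simp: fibre_def\<close>)

lemma permutes_fibrewise:
  assumes "finite A" "\<And>k. \<sigma> k permutes fibre c A k"
  shows "(\<lambda>x. \<sigma> (c x) x) permutes A" "c (\<sigma> (c x) x) = c x"
proof -
  have fibre: "\<sigma> k x \<in> fibre c A k \<longleftrightarrow> x \<in> fibre c A k" for k x
    using assms(2) by (rule permutes_in_image)
  have fixed: "\<sigma> (c x) x = x" if "x \<notin> A" for x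
    using assms(2) that by (auto simp: fibre_def intro: permutes_not_in)
  show c_eq: "c (\<sigma> (c x) x) = c x" for x
    using fibre[of "c x" x] fixed[of x] by (cases "x \<in> A") (auto simp: fibre_def)
  show "(\<lambda>x. \<sigma> (c x) x) permutes A"
  proof (rule inj_imp_permutes)
    show "inj_on (\<lambda>x. \<sigma> (c x) x) A"
      using c_eq permutes_inj[OF assms(2)] by (metis (mono_tags, lifting) inj_onI injD)
    show "\<sigma> (c x) x \<in> A" if "x \<in> A" for x
      using fibre[of "c x" x] that by (simp add: fibre_def)
  qed (use assms(1) fixed in auto)
qed

lemma fibrewise_sorts_unique:
  fixes c :: "'a::linorder \<Rightarrow> 'b" and g :: "'a \<Rightarrow> 'c::linorder"
  assumes "finite A" "\<And>k. inj_on g (fibre c A k)"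
    and \<sigma>: "fibrewise_sorts c A g \<sigma>" and \<tau>: "fibrewise_sorts c A g \<tau>"
  shows "\<sigma> = \<tau>"
proof
  fix x
  show "\<sigma> x = \<tau> x"
  proof (cases "x \<in> A")
    case True
    then have x: "x \<in> fibre c A (c x)" by (simp add: fibre_def)
    have image: "\<sigma> ` fibre c A (c x) = fibre c A (c x)" "\<tau> ` fibre c A (c x) = fibre c A (c x)"
      using \<sigma> \<tau> permutes_image_fibre unfolding fibrewise_sorts_def by metis+
    have "(g \<circ> \<sigma>) x = (g \<circ> \<tau>) x"
    proof (rule strict_mono_on_image_eq_imp_eq[of _ "g \<circ> \<sigma>" "g \<circ> \<tau>"])
      show "(g \<circ> \<sigma>) ` fibre c A (c x) = (g \<circ> \<tau>) ` fibre c A (c x)"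
        using image by (metis image_comp)
      show "finite (fibre c A (c x))"
        using assms(1) by (simp add: fibre_def)
    qed (use \<sigma> \<tau> x in \<open>simp_all add: fibrewise_sorts_def\<close>)
    moreover have "\<sigma> x \<in> fibre c A (c x)" "\<tau> x \<in> fibre c A (c x)"
      using x image by blast+
    ultimately show ?thesis using assms(2) by (auto dest: inj_onD)
  next
    case False
    then show ?thesis using \<sigma> \<tau> unfolding fibrewise_sorts_def by (metis permutes_not_in)
  qed
qed

lemma ex1_fibrewise_sorts:
  fixes c :: "'a::linorder \<Rightarrow> 'b" and g :: "'a \<Rightarrow> 'c::linorder"
  assumes "finite A" "\<And>k. inj_on g (fibre c A k)"
  shows "\<exists>!\<sigma>. fibrewise_sorts c A g \<sigma>"
proof -
  have "\<exists>\<sigma>. \<sigma> permutes fibre c A k \<and> strict_mono_on (fibre c A k) (g \<circ> \<sigma>)" for k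
  proof -
    let ?F = "fibre c A k"
    have fin: "finite ?F" using assms(1) by (simp add: fibre_def)
    then obtain h where h: "bij_betw h ?F (g ` ?F)" "strict_mono_on ?F h"
      using obtain_strict_mono_bij_betw[of ?F "g ` ?F"] card_image[OF assms(2)]
      by (metis finite_imageI)
    define \<sigma> where "\<sigma> = inv_into ?F g \<circ> h"
    have "bij_betw \<sigma> ?F ?F"
      unfolding \<sigma>_def using h(1) bij_betw_inv_into[OF inj_on_imp_bij_betw[OF assms(2)]]
      by (rule bij_betw_trans)
    moreover have "g (\<sigma> x) = h x" if "x \<in> ?F" for x
      unfolding \<sigma>_def using that bij_betw_apply[OF h(1)] by (simp add: f_inv_into_f)
    ultimately show ?thesis
      using h(2) permutes_restrict_id
      by (intro exI[of _ "restrict_id \<sigma> ?F"]) (auto simp: monotone_on_def)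
  qed
  then obtain \<sigma> where \<sigma>: "\<And>k. \<sigma> k permutes fibre c A k"
    "\<And>k. strict_mono_on (fibre c A k) (g \<circ> \<sigma> k)"
    by metis
  have "fibrewise_sorts c A g (\<lambda>x. \<sigma> (c x) x)"
    unfolding fibrewise_sorts_def
  proof (intro conjI allI)
    show "strict_mono_on (fibre c A k) (g \<circ> (\<lambda>x. \<sigma> (c x) x))" for k
      using \<sigma>(2)[of k] by (auto simp: monotone_on_def fibre_def)
  qed (use permutes_fibrewise[OF assms(1) \<sigma>(1)] in blast)+
  then show ?thesis
    using fibrewise_sorts_unique[OF assms] by blast
qed

lemma fibrewise_sorts_conjugate:
  fixes c :: "'a::order \<Rightarrow> 'b" and g :: "'a \<Rightarrow> 'c::order"
  assumes r: "r permutes A" "\<And>x. c (r x) = c x"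
    and r_antimono: "\<And>k. strict_antimono_on (fibre c A k) r"
    and g_reversed: "\<And>x y. x \<in> A \<Longrightarrow> y \<in> A \<Longrightarrow> c x = c y \<Longrightarrow> g x < g y \<Longrightarrow> g (r y) < g (r x)"
    and \<sigma>: "fibrewise_sorts c A g \<sigma>"
  shows "fibrewise_sorts c A g (r \<circ> \<sigma> \<circ> r)"
  unfolding fibrewise_sorts_def
proof (intro conjI allI)
  have \<sigma>_perm: "\<sigma> permutes A" and \<sigma>_c: "c (\<sigma> x) = c x" for x
    using \<sigma> by (simp_all add: fibrewise_sorts_def)
  show "r \<circ> \<sigma> \<circ> r permutes A"
    by (intro permutes_compose r(1) \<sigma>_perm)
  show "c ((r \<circ> \<sigma> \<circ> r) x) = c x" for x
    by (simp add: r(2) \<sigma>_c)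
  show "strict_mono_on (fibre c A k) (g \<circ> (r \<circ> \<sigma> \<circ> r))" for k
  proof (rule strict_mono_onI)
    fix x y assume xy: "x \<in> fibre c A k" "y \<in> fibre c A k" "x < y"
    then have "r y < r x" using r_antimono by (auto simp: monotone_on_def)
    moreover have "r x \<in> fibre c A k" "r y \<in> fibre c A k"
      using xy r(2) permutes_in_image[OF r(1)] by (auto simp: fibre_def)
    ultimately have "g (\<sigma> (r y)) < g (\<sigma> (r x))"
      using \<sigma> by (auto simp: fibrewise_sorts_def monotone_on_def)
    then show "(g \<circ> (r \<circ> \<sigma> \<circ> r)) x < (g \<circ> (r \<circ> \<sigma> \<circ> r)) y"
      using xy r(2) \<sigma>_c permutes_in_image[OF r(1)] permutes_in_image[OF \<sigma>_perm]
      by (auto simp: fibre_def intro!: g_reversed)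
  qed
qed

section \<open>Permutations commuting with reflection\<close>

definition reflect :: "nat \<Rightarrow> nat \<Rightarrow> nat" where
  "reflect m = restrict_id (\<lambda>i. m + 1 - i) {1..m}"

lemma reflect_eq [simp]: "i \<in> {1..m} \<Longrightarrow> reflect m i = m + 1 - i"
  by (simp add: reflect_def)

lemma reflect_reflect [simp]: "reflect m (reflect m i) = i"
  by (auto simp: reflect_def restrict_id_def)

lemma reflect_permutes: "reflect m permutes {1..m}"
  unfolding reflect_def
  by (intro permutes_restrict_id bij_betw_byWitness[where f' = "\<lambda>i. m + 1 - i"]) auto

lemma even_reflect: "odd m \<Longrightarrow> even (reflect m i) \<longleftrightarrow> even i"
  by (auto simp: reflect_def restrict_id_def)

lemma reflect_eq_self_iff: "odd m \<Longrightarrow> i \<in> {1..m} \<Longrightarrow> reflect m i = i \<longleftrightarrow> i = m div 2 + 1"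
  by (auto simp: reflect_def restrict_id_def elim!: oddE)

lemma reflect_notin_lower_half: "i \<in> {1..m div 2} \<Longrightarrow> reflect m i \<notin> {1..m div 2}"
  by (auto simp: reflect_def)

lemma lower_half_cases:
  assumes "odd m" "i \<in> {1..m}"
  obtains "i \<in> {1..m div 2}" | "i = m div 2 + 1" | "reflect m i \<in> {1..m div 2}"
  using assms by (fastforce elim!: oddE)

lemma ball_reflect_iff:
  fixes m :: nat
  assumes "odd m"
  shows "(\<forall>i\<in>{1..m}. P i) \<longleftrightarrow> P (m div 2 + 1) \<and> (\<forall>i\<in>{1..m div 2}. P i \<and> P (m + 1 - i))"
    (is "_ \<longleftrightarrow> ?halves")
proof
  have "m div 2 + 1 \<in> {1..m}" using assms by (auto elim: oddE)
  moreover have "i \<in> {1..m}" "m + 1 - i \<in> {1..m}" if "i \<in> {1..m div 2}" for i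
    using that by auto
  ultimately show ?halves if "\<forall>i\<in>{1..m}. P i"
    using that by blast
next
  assume ?halves
  show "\<forall>i\<in>{1..m}. P i"
  proof
    fix i assume i: "i \<in> {1..m}"
    from assms i show "P i"
    proof (cases rule: lower_half_cases)
      case 3
      then have "P (m + 1 - reflect m i)" using \<open>?halves\<close> by blast
      then show ?thesis using i by simp
    qed (use \<open>?halves\<close> in auto)
  qed
qed

lemma permutes_disjoint_commute:
  assumes "p permutes A" "q permutes B" "A \<inter> B = {}"
  shows "p (q x) = q (p x)"
proof -
  consider "x \<in> A" | "x \<in> B" | "x \<notin> A \<union> B" by blast
  then show ?thesis
  proof cases
    case 1
    then have "x \<notin> B" "p x \<notin> B"
      using assms permutes_in_image[OF assms(1)] by blast+
    then show ?thesis using permutes_not_in[OF assms(2)] by simp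
  next
    case 2
    then have "x \<notin> A" "q x \<notin> A"
      using assms permutes_in_image[OF assms(2)] by blast+
    then show ?thesis using permutes_not_in[OF assms(1)] by simp
  next
    case 3
    then show ?thesis using permutes_not_in[OF assms(1)] permutes_not_in[OF assms(2)] by simp
  qed
qed

lemma reflect_conjugate_permutes:
  assumes "\<eta> permutes A"
  shows "reflect m \<circ> \<eta> \<circ> reflect m permutes reflect m ` A"
proof (rule bij_imp_permutes)
  have "reflect m ` reflect m ` A = A" by (simp add: image_image)
  then show "bij_betw (reflect m \<circ> \<eta> \<circ> reflect m) (reflect m ` A) (reflect m ` A)"
    using permutes_inj_on[OF reflect_permutes] permutes_inj_on[OF assms] permutes_image[OF assms]
    unfolding bij_betw_def image_comp[symmetric] by (simp add: comp_inj_on)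
next
  fix x assume "x \<notin> reflect m ` A"
  then have "reflect m x \<notin> A" by (metis imageI reflect_reflect)
  then show "(reflect m \<circ> \<eta> \<circ> reflect m) x = x" using permutes_not_in[OF assms] by simp
qed

definition symmetric_perm :: "nat \<Rightarrow> (nat \<Rightarrow> nat) \<Rightarrow> bool" where
  "symmetric_perm m \<sigma> \<longleftrightarrow>
     \<sigma> permutes {1..m} \<and> (\<forall>i. even (\<sigma> i) \<longleftrightarrow> even i) \<and> (\<forall>i. \<sigma> (reflect m i) = reflect m (\<sigma> i))"

lemma symmetric_perm_in_iff: "symmetric_perm m \<sigma> \<Longrightarrow> \<sigma> i \<in> {1..m} \<longleftrightarrow> i \<in> {1..m}"
  unfolding symmetric_perm_def by (metis permutes_in_image)

lemma symmetric_perm_id: "symmetric_perm m id"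
  by (simp add: symmetric_perm_def permutes_id)

lemma symmetric_perm_comp:
  "symmetric_perm m \<sigma> \<Longrightarrow> symmetric_perm m \<tau> \<Longrightarrow> symmetric_perm m (\<sigma> \<circ> \<tau>)"
  by (simp add: symmetric_perm_def permutes_compose)

lemma symmetric_perm_inv:
  assumes "symmetric_perm m \<sigma>"
  shows "symmetric_perm m (inv \<sigma>)"
proof -
  have \<sigma>: "\<sigma> permutes {1..m}" "\<And>i. even (\<sigma> i) \<longleftrightarrow> even i"
    "\<And>i. \<sigma> (reflect m i) = reflect m (\<sigma> i)"
    using assms by (simp_all add: symmetric_perm_def)
  have "inv \<sigma> (reflect m i) = reflect m (inv \<sigma> i)" for i
    unfolding permutes_inv_eq[OF \<sigma>(1)] by (simp add: \<sigma>(3) permutes_inverses[OF \<sigma>(1)])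
  moreover have "even (inv \<sigma> i) \<longleftrightarrow> even i" for i
    using \<sigma>(2)[of "inv \<sigma> i"] by (simp add: permutes_inverses[OF \<sigma>(1)])
  ultimately show ?thesis
    using \<sigma>(1) by (simp add: symmetric_perm_def permutes_inv)
qed

lemma symmetric_perm_minus:
  assumes "symmetric_perm m \<sigma>" "i \<in> {1..m}"
  shows "\<sigma> (m + 1 - i) = m + 1 - \<sigma> i"
  using assms symmetric_perm_in_iff[OF assms(1), of i]
  by (metis reflect_eq symmetric_perm_def)

lemma symmetric_perm_center:
  assumes "odd m" "symmetric_perm m \<sigma>"
  shows "\<sigma> (m div 2 + 1) = m div 2 + 1"
proof -
  have center: "m div 2 + 1 \<in> {1..m}" using assms(1) by (auto elim: oddE)
  then have "reflect m (\<sigma> (m div 2 + 1)) = \<sigma> (m div 2 + 1)"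
    using assms reflect_eq_self_iff by (metis symmetric_perm_def)
  then show ?thesis
    using reflect_eq_self_iff symmetric_perm_in_iff assms center by metis
qed

definition mirror_perm :: "nat \<Rightarrow> (nat \<Rightarrow> nat) \<Rightarrow> nat \<Rightarrow> nat" where
  "mirror_perm m \<eta> = \<eta> \<circ> (reflect m \<circ> \<eta> \<circ> reflect m)"

lemma mirror_perm_lower_half:
  assumes "\<eta> permutes {1..m div 2}" "i \<in> {1..m div 2}"
  shows "mirror_perm m \<eta> i = \<eta> i"
  using permutes_not_in[OF assms(1)] reflect_notin_lower_half[OF assms(2)]
  by (simp add: mirror_perm_def)

lemma symmetric_perm_mirror_perm:
  assumes "odd m" and \<eta>: "\<eta> permutes {1..m div 2}" and \<eta>_even: "\<And>i. even (\<eta> i) \<longleftrightarrow> even i"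
  shows "symmetric_perm m (mirror_perm m \<eta>)"
  unfolding symmetric_perm_def
proof (intro conjI allI)
  have "\<eta> permutes {1..m}" using \<eta> by (rule permutes_subset) auto
  then show "mirror_perm m \<eta> permutes {1..m}"
    unfolding mirror_perm_def by (intro permutes_compose reflect_permutes)
  show "even (mirror_perm m \<eta> i) \<longleftrightarrow> even i" for i
    by (simp add: mirror_perm_def \<eta>_even even_reflect[OF assms(1)])
  have commute: "\<eta> ((reflect m \<circ> \<eta> \<circ> reflect m) i) = (reflect m \<circ> \<eta> \<circ> reflect m) (\<eta> i)" for i
    by (rule permutes_disjoint_commute[OF \<eta> reflect_conjugate_permutes[OF \<eta>]])
      (use reflect_notin_lower_half in blast)
  show "mirror_perm m \<eta> (reflect m i) = reflect m (mirror_perm m \<eta> i)" for i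
    using commute[of "reflect m i"] by (simp add: mirror_perm_def)
qed

definition partial_reflect :: "nat \<Rightarrow> nat set \<Rightarrow> nat \<Rightarrow> nat" where
  "partial_reflect m T = restrict_id (reflect m) (T \<union> reflect m ` T)"

lemma partial_reflect_lower_half:
  assumes "T \<subseteq> {1..m div 2}" "i \<in> {1..m div 2}"
  shows "partial_reflect m T i = (if i \<in> T then m + 1 - i else i)"
  using assms reflect_notin_lower_half by (fastforce simp: partial_reflect_def restrict_id_def)

lemma reflect_in_Un_image_iff:
  "reflect m i \<in> T \<union> reflect m ` T \<longleftrightarrow> i \<in> T \<union> reflect m ` T"
  by (metis (no_types, lifting) Un_iff image_iff reflect_reflect)

lemma partial_reflect_involutory: "partial_reflect m T (partial_reflect m T i) = i"
  by (simp add: partial_reflect_def restrict_id_def reflect_in_Un_image_iff del: Un_iff)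

lemma symmetric_perm_partial_reflect:
  assumes "odd m"
  shows "symmetric_perm m (partial_reflect m T)"
  unfolding symmetric_perm_def
proof (intro conjI allI)
  show "partial_reflect m T permutes {1..m}"
  proof (rule inj_imp_permutes)
    show "inj_on (partial_reflect m T) {1..m}"
      by (metis inj_onI partial_reflect_involutory)
    show "partial_reflect m T i \<in> {1..m}" if "i \<in> {1..m}" for i
      using that permutes_in_image[OF reflect_permutes]
      by (auto simp: partial_reflect_def restrict_id_def)
    show "partial_reflect m T i = i" if "i \<notin> {1..m}" for i
      using that permutes_not_in[OF reflect_permutes]
      by (simp add: partial_reflect_def restrict_id_def)
  qed simp
  show "even (partial_reflect m T i) \<longleftrightarrow> even i" for i
    by (simp add: partial_reflect_def restrict_id_def even_reflect[OF assms])
  show "partial_reflect m T (reflect m i) = reflect m (partial_reflect m T i)" for i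
    by (simp add: partial_reflect_def restrict_id_def reflect_in_Un_image_iff del: Un_iff)
qed

lemma symmetric_perm_factor:
  assumes "odd m" "symmetric_perm m \<sigma>"
  obtains \<rho> T where "symmetric_perm m \<rho>" "\<rho> ` {1..m div 2} \<subseteq> {1..m div 2}"
    "T \<subseteq> {1..m div 2}" "\<sigma> = \<rho> \<circ> partial_reflect m T"
proof -
  let ?L = "{1..m div 2}"
  define T where "T = {i \<in> ?L. reflect m (\<sigma> i) \<in> ?L}"
  define \<rho> where "\<rho> = \<sigma> \<circ> partial_reflect m T"
  have T: "T \<subseteq> ?L" by (auto simp: T_def)
  have "\<rho> i \<in> ?L" if i: "i \<in> ?L" for i
  proof -
    have im: "i \<in> {1..m}" "i \<noteq> m div 2 + 1" using i by auto
    have "\<sigma> i \<noteq> m div 2 + 1"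
      using im(2) assms symmetric_perm_center[OF assms]
      by (metis injD permutes_inj symmetric_perm_def)
    moreover have "\<sigma> i \<in> {1..m}"
      using im(1) symmetric_perm_in_iff[OF assms(2)] by blast
    ultimately have "\<sigma> i \<in> ?L \<or> i \<in> T"
      using lower_half_cases[OF assms(1)] i unfolding T_def by blast
    moreover have "\<sigma> (m + 1 - i) = reflect m (\<sigma> i)"
      using assms(2) im(1) by (metis reflect_eq symmetric_perm_def)
    ultimately show "\<rho> i \<in> ?L"
      using i T by (auto simp: \<rho>_def partial_reflect_lower_half T_def)
  qed
  moreover have "symmetric_perm m \<rho>"
    unfolding \<rho>_def by (intro symmetric_perm_comp symmetric_perm_partial_reflect assms)
  moreover have "\<sigma> = \<rho> \<circ> partial_reflect m T"
    by (simp add: \<rho>_def fun_eq_iff partial_reflect_involutory)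
  ultimately show thesis using that T by blast
qed

section \<open>Elementary operations as relabelings\<close>

definition relabel ::
  "nat \<Rightarrow> nat \<Rightarrow> (nat \<times> nat \<Rightarrow> 'a) \<Rightarrow> (nat \<Rightarrow> nat) \<Rightarrow> (nat \<Rightarrow> nat) \<Rightarrow> nat \<times> nat \<Rightarrow> 'a" where
  "relabel m n x \<sigma> \<tau> = restrict (x \<circ> map_prod \<sigma> \<tau>) (grid m n)"

lemma relabel_extensional [simp]: "relabel m n x \<sigma> \<tau> \<in> extensional (grid m n)"
  by (simp add: relabel_def)

lemma relabel_apply: "i \<in> {1..m} \<Longrightarrow> j \<in> {1..n} \<Longrightarrow> relabel m n x \<sigma> \<tau> (i, j) = x (\<sigma> i, \<tau> j)"
  by (simp add: relabel_def grid_def)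

lemma eq_relabel_iff:
  "z = relabel m n x \<sigma> \<tau> \<longleftrightarrow>
     z \<in> extensional (grid m n) \<and> (\<forall>i\<in>{1..m}. \<forall>j\<in>{1..n}. z (i, j) = x (\<sigma> i, \<tau> j))"
proof
  assume z: "z \<in> extensional (grid m n) \<and> (\<forall>i\<in>{1..m}. \<forall>j\<in>{1..n}. z (i, j) = x (\<sigma> i, \<tau> j))"
  show "z = relabel m n x \<sigma> \<tau>"
    proof (rule extensionalityI)
    show "z v = relabel m n x \<sigma> \<tau> v" if "v \<in> grid m n" for v
      using that z by (auto simp: grid_def relabel_apply)
  qed (use z in simp_all)
qed (auto simp: relabel_apply)

lemma relabel_relabel:
  assumes "symmetric_perm m \<sigma>'" "symmetric_perm n \<tau>'"
  shows "relabel m n (relabel m n x \<sigma> \<tau>) \<sigma>' \<tau>' = relabel m n x (\<sigma> \<circ> \<sigma>') (\<tau> \<circ> \<tau>')"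
  unfolding eq_relabel_iff
  using symmetric_perm_in_iff[OF assms(1)] symmetric_perm_in_iff[OF assms(2)]
  by (simp add: relabel_apply del: atLeastAtMost_iff)

lemma relabel_id: "x \<in> extensional (grid m n) \<Longrightarrow> relabel m n x id id = x"
  by (rule sym) (simp add: eq_relabel_iff)

definition symmetric_relabeling ::
  "nat \<Rightarrow> nat \<Rightarrow> (nat \<times> nat \<Rightarrow> 'a) \<Rightarrow> (nat \<times> nat \<Rightarrow> 'a) \<Rightarrow> bool" where
  "symmetric_relabeling m n x z \<longleftrightarrow>
     (\<exists>\<sigma> \<tau>. symmetric_perm m \<sigma> \<and> symmetric_perm n \<tau> \<and> z = relabel m n x \<sigma> \<tau>)"

lemma symmetric_relabeling_refl: "x \<in> extensional (grid m n) \<Longrightarrow> symmetric_relabeling m n x x"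
  using symmetric_perm_id relabel_id unfolding symmetric_relabeling_def by metis

lemma symmetric_relabeling_trans:
  assumes "symmetric_relabeling m n x y" "symmetric_relabeling m n y z"
  shows "symmetric_relabeling m n x z"
proof -
  obtain \<sigma> \<tau> where y: "symmetric_perm m \<sigma>" "symmetric_perm n \<tau>" "y = relabel m n x \<sigma> \<tau>"
    using assms(1) unfolding symmetric_relabeling_def by blast
  obtain \<sigma>' \<tau>' where z: "symmetric_perm m \<sigma>'" "symmetric_perm n \<tau>'" "z = relabel m n y \<sigma>' \<tau>'"
    using assms(2) unfolding symmetric_relabeling_def by blast
  have "z = relabel m n x (\<sigma> \<circ> \<sigma>') (\<tau> \<circ> \<tau>')"
    using y(3) z(3) relabel_relabel[OF z(1,2)] by simp
  then show ?thesis
    using y(1,2) z(1,2) symmetric_perm_comp unfolding symmetric_relabeling_def by blast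
qed

lemma symmetric_relabeling_sym:
  assumes "x \<in> extensional (grid m n)" "symmetric_relabeling m n x z"
  shows "symmetric_relabeling m n z x"
proof -
  obtain \<sigma> \<tau> where \<sigma>: "symmetric_perm m \<sigma>" and \<tau>: "symmetric_perm n \<tau>"
    and z: "z = relabel m n x \<sigma> \<tau>"
    using assms(2) unfolding symmetric_relabeling_def by blast
  have "\<sigma> \<circ> inv \<sigma> = id" "\<tau> \<circ> inv \<tau> = id"
    using \<sigma> \<tau> permutes_inv_o(1) unfolding symmetric_perm_def by blast+
  then have "x = relabel m n z (inv \<sigma>) (inv \<tau>)"
    using \<sigma> \<tau> assms(1) by (simp add: z relabel_relabel symmetric_perm_inv relabel_id)
  then show ?thesis
    using \<sigma> \<tau> symmetric_perm_inv unfolding symmetric_relabeling_def by blast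
qed

lemma relabel_transpose:
  "relabel n m (x \<circ> prod.swap) \<tau> \<sigma> = relabel m n x \<sigma> \<tau> \<circ> prod.swap"
  by (auto simp: fun_eq_iff relabel_def restrict_def grid_def)

lemma extensional_grid_transpose:
  "z \<circ> prod.swap \<in> extensional (grid n m) \<longleftrightarrow> z \<in> extensional (grid m n)"
  by (auto simp: extensional_def grid_def)

lemma comp_swap_eq_iff: "x \<circ> prod.swap = y \<circ> prod.swap \<longleftrightarrow> x = y"
  by (metis comp_assoc comp_id swap_comp_swap)

lemma eq_relabel_columns_iff:
  assumes "odd m" "symmetric_perm m \<rho>"
  shows "z = relabel m n x \<rho> id \<longleftrightarrow> z \<in> extensional (grid m n) \<and>
    (\<forall>j\<in>{1..n}. z (m div 2 + 1, j) = x (m div 2 + 1, j) \<and>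
      (\<forall>i\<in>{1..m div 2}. z (i, j) = x (\<rho> i, j) \<and> z (m + 1 - i, j) = x (m + 1 - \<rho> i, j)))"
proof -
  have "\<rho> (m + 1 - i) = m + 1 - \<rho> i" if "i \<in> {1..m div 2}" for i
    using that by (intro symmetric_perm_minus[OF assms(2)]) auto
  then show ?thesis
    unfolding eq_relabel_iff ball_reflect_iff[OF assms(1)] symmetric_perm_center[OF assms]
    by (simp del: atLeastAtMost_iff) blast
qed

lemma column_perm_op_iff_relabel:
  assumes "odd m"
  shows "z \<in> extensional (grid m n) \<and> column_perm_op m n x z \<longleftrightarrow>
    (\<exists>\<rho>. symmetric_perm m \<rho> \<and> \<rho> ` {1..m div 2} \<subseteq> {1..m div 2} \<and> z = relabel m n x \<rho> id)"
    (is "?op \<longleftrightarrow> ?relabeling")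
proof
  let ?L = "{1..m div 2}"
  assume ?op
  then obtain \<eta> where \<eta>: "\<eta> permutes ?L" "\<forall>i\<in>?L. \<eta> i mod 2 = i mod 2"
    and z: "\<forall>j\<in>{1..n}. z (m div 2 + 1, j) = x (m div 2 + 1, j) \<and>
      (\<forall>i\<in>?L. z (i, j) = x (\<eta> i, j) \<and> z (m + 1 - i, j) = x (m + 1 - \<eta> i, j))"
    unfolding column_perm_op_def by blast
  have "even (\<eta> i) \<longleftrightarrow> even i" for i
    using \<eta>(2) permutes_not_in[OF \<eta>(1), of i] by (metis even_iff_mod_2_eq_zero)
  then have symmetric: "symmetric_perm m (mirror_perm m \<eta>)"
    using symmetric_perm_mirror_perm[OF assms \<eta>(1)] by blast
  moreover have "z = relabel m n x (mirror_perm m \<eta>) id"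
    unfolding eq_relabel_columns_iff[OF assms symmetric]
    using mirror_perm_lower_half[OF \<eta>(1)] z \<open>?op\<close> by simp
  moreover have "mirror_perm m \<eta> ` ?L \<subseteq> ?L"
    using mirror_perm_lower_half[OF \<eta>(1)] permutes_in_image[OF \<eta>(1)] by auto
  ultimately show ?relabeling by blast
next
  let ?L = "{1..m div 2}"
  assume ?relabeling
  then obtain \<rho> where \<rho>: "symmetric_perm m \<rho>" "\<rho> ` ?L \<subseteq> ?L" and z: "z = relabel m n x \<rho> id"
    by blast
  have "inj_on \<rho> ?L"
    using \<rho>(1) permutes_inj_on unfolding symmetric_perm_def by blast
  then have "restrict_id \<rho> ?L permutes ?L"
    using endo_inj_surj[OF _ \<rho>(2)] by (intro permutes_restrict_id) (simp add: bij_betw_def)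
  moreover have "\<forall>i\<in>?L. restrict_id \<rho> ?L i mod 2 = i mod 2"
    using \<rho>(1) by (simp add: symmetric_perm_def mod2_eq_if)
  ultimately have "column_perm_op m n x z"
    unfolding column_perm_op_def using z[unfolded eq_relabel_columns_iff[OF assms \<rho>(1)]]
    by (intro exI[of _ "restrict_id \<rho> ?L"]) simp
  then show ?op using z by simp
qed

lemma column_swap_op_iff_relabel:
  assumes "odd m"
  shows "z \<in> extensional (grid m n) \<and> column_swap_op m n x z \<longleftrightarrow>
    (\<exists>T\<subseteq>{1..m div 2}. z = relabel m n x (partial_reflect m T) id)"
    (is "?op \<longleftrightarrow> ?relabeling")
proof -
  let ?L = "{1..m div 2}"
  have relabel_iff: "z = relabel m n x (partial_reflect m T) id \<longleftrightarrow>
      z \<in> extensional (grid m n) \<and> (\<forall>j\<in>{1..n}. z (m div 2 + 1, j) = x (m div 2 + 1, j) \<and>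
        (\<forall>i\<in>?L. z (i, j) = (if i \<in> T then x (m + 1 - i, j) else x (i, j)) \<and>
          z (m + 1 - i, j) = (if i \<in> T then x (i, j) else x (m + 1 - i, j))))"
    if "T \<subseteq> ?L" for T
  proof -
    have "partial_reflect m T i = (if i \<in> T then m + 1 - i else i)"
      "m + 1 - partial_reflect m T i = (if i \<in> T then i else m + 1 - i)" if "i \<in> ?L" for i
      using partial_reflect_lower_half[OF \<open>T \<subseteq> ?L\<close> that] that by auto
    then show ?thesis
      unfolding eq_relabel_columns_iff[OF assms symmetric_perm_partial_reflect[OF assms]] by simp
  qed
  show ?thesis
  proof
    assume ?op
    then obtain \<alpha> :: "nat \<Rightarrow> nat" where z: "\<forall>j\<in>{1..n}. z (m div 2 + 1, j) = x (m div 2 + 1, j) \<and>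
        (\<forall>i\<in>?L. z (i, j) = (if \<alpha> i = 1 then x (m + 1 - i, j) else x (i, j)) \<and>
          z (m + 1 - i, j) = (if \<alpha> i = 1 then x (i, j) else x (m + 1 - i, j)))"
      unfolding column_swap_op_def by metis
    have "{i \<in> ?L. \<alpha> i = 1} \<subseteq> ?L" by blast
    moreover from this have "z = relabel m n x (partial_reflect m {i \<in> ?L. \<alpha> i = 1}) id"
      using relabel_iff[of "{i \<in> ?L. \<alpha> i = 1}"] z \<open>?op\<close> by simp
    ultimately show ?relabeling by blast
  next
    assume ?relabeling
    then obtain T where T: "T \<subseteq> ?L" and z: "z = relabel m n x (partial_reflect m T) id"
      by blast
    have "column_swap_op m n x z"
      unfolding column_swap_op_def using z[unfolded relabel_iff[OF T]]
      by (intro exI[of _ "\<lambda>i. of_bool (i \<in> T)"]) simp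
    then show ?op using z by simp
  qed
qed

lemma row_perm_op_transpose:
  "row_perm_op m n x z \<longleftrightarrow> column_perm_op n m (x \<circ> prod.swap) (z \<circ> prod.swap)"
  by (simp add: row_perm_op_def column_perm_op_def)

lemma row_swap_op_transpose:
  "row_swap_op m n x z \<longleftrightarrow> column_swap_op n m (x \<circ> prod.swap) (z \<circ> prod.swap)"
  by (simp add: row_swap_op_def column_swap_op_def)

lemma row_perm_op_iff_relabel:
  assumes "odd n"
  shows "z \<in> extensional (grid m n) \<and> row_perm_op m n x z \<longleftrightarrow>
    (\<exists>\<rho>. symmetric_perm n \<rho> \<and> \<rho> ` {1..n div 2} \<subseteq> {1..n div 2} \<and> z = relabel m n x id \<rho>)"
  using column_perm_op_iff_relabel[OF assms, of "z \<circ> prod.swap" m "x \<circ> prod.swap"]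
  unfolding relabel_transpose extensional_grid_transpose comp_swap_eq_iff row_perm_op_transpose .

lemma row_swap_op_iff_relabel:
  assumes "odd n"
  shows "z \<in> extensional (grid m n) \<and> row_swap_op m n x z \<longleftrightarrow>
    (\<exists>T\<subseteq>{1..n div 2}. z = relabel m n x id (partial_reflect n T))"
  using column_swap_op_iff_relabel[OF assms, of "z \<circ> prod.swap" m "x \<circ> prod.swap"]
  unfolding relabel_transpose extensional_grid_transpose comp_swap_eq_iff row_swap_op_transpose .

lemma elementary_op_imp_symmetric_relabeling:
  assumes "odd m" "odd n" "elementary_op m n x z"
  shows "symmetric_relabeling m n x z"
proof -
  have z: "z \<in> extensional (grid m n)" using assms(3) by (simp add: elementary_op_def)
  consider "column_perm_op m n x z" | "column_swap_op m n x z"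
    | "row_perm_op m n x z" | "row_swap_op m n x z"
    using assms(3) unfolding elementary_op_def by blast
  then show ?thesis
    proof cases
    case 1
    then show ?thesis
      unfolding symmetric_relabeling_def
      using z column_perm_op_iff_relabel[OF assms(1)] symmetric_perm_id by metis
  next
    case 2
    then show ?thesis
      unfolding symmetric_relabeling_def
      using z column_swap_op_iff_relabel[OF assms(1)] symmetric_perm_id
        symmetric_perm_partial_reflect[OF assms(1)] by metis
  next
    case 3
    then show ?thesis
      unfolding symmetric_relabeling_def
      using z row_perm_op_iff_relabel[OF assms(2)] symmetric_perm_id by metis
  next
    case 4
    then show ?thesis
      unfolding symmetric_relabeling_def
      using z row_swap_op_iff_relabel[OF assms(2)] symmetric_perm_id
        symmetric_perm_partial_reflect[OF assms(2)] by metis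
  qed
qed

lemma rtranclp_elementary_op_imp_symmetric_relabeling:
  assumes "odd m" "odd n" "x \<in> extensional (grid m n)" "(elementary_op m n)\<^sup>*\<^sup>* x z"
  shows "symmetric_relabeling m n x z"
  using assms(4)
proof (induction rule: rtranclp_induct)
  case base
  then show ?case using assms(3) by (rule symmetric_relabeling_refl)
next
  case (step y z)
  then show ?case
    using elementary_op_imp_symmetric_relabeling[OF assms(1,2)] symmetric_relabeling_trans by blast
qed

section \<open>Sequences along a parity class\<close>

lemma transp_imp_rel_same_parity:
  fixes f :: "nat \<Rightarrow> 'a"
  assumes "transp R" and step: "\<And>i. i \<in> {1..m - 2} \<Longrightarrow> R (f i) (f (i + 2))"
    and "1 \<le> i" "i < l" "l \<le> m" "even i = even l"
  shows "R (f i) (f l)"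
proof -
  have "even (l - i)" "l - i > 0" using assms(4,6) by simp_all
  then obtain t where "l - i = 2 * Suc t" by (metis evenE gr0_conv_Suc mult_0_right not_gr_zero)
  then have l: "l = i + 2 * Suc t" by simp
  have "R (f i) (f (i + 2 * Suc t))" if "i + 2 * Suc t \<le> m" for t
    using that
  proof (induction t)
    case 0
    then show ?case using step[of i] \<open>1 \<le> i\<close> by simp
  next
    case (Suc t)
    then have "R (f i) (f (i + 2 * Suc t))" by simp
    moreover have "R (f (i + 2 * Suc t)) (f (i + 2 * Suc (Suc t)))"
      using step[of "i + 2 * Suc t"] Suc.prems \<open>1 \<le> i\<close> by (simp add: algebra_simps)
    ultimately show ?case using \<open>transp R\<close> by (rule transpD[rotated])
  qed
  then show ?thesis using l \<open>l \<le> m\<close> by blast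
qed

lemma consecutive_sums_eq_imp_sum_eq:
  fixes a :: "nat \<Rightarrow> 'a::cancel_ab_semigroup_add"
  assumes sums: "\<And>i. i \<in> {1..m - 1} \<Longrightarrow> a i + a (i + 1) = c"
    and "i \<in> {1..m}" "l \<in> {1..m}" "even i \<noteq> even l"
  shows "a i + a l = c"
  using assms(2-4)
proof (induction i l rule: linorder_wlog)
  case (le i l)
  then have "i < l" by (metis le_neq_implies_less)
  have period: "a i = a (i + 2)" if "i \<in> {1..m - 2}" for i
  proof -
    have "i \<in> {1..m - 1}" "i + 1 \<in> {1..m - 1}" using that by auto
    then have "a (i + 1) + a i = a (i + 1) + a (i + 2)"
      using sums[of i] sums[of "i + 1"] by (simp add: add.commute)
    then show ?thesis by simp
  qed
  have "a (i + 1) = a l"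
  proof (cases "l = i + 1")
    case False
    show ?thesis
      by (rule transp_imp_rel_same_parity[of "(=)" m a]) (use period le \<open>i < l\<close> False in auto)
  qed simp
  then show ?case using sums[of i] le \<open>i < l\<close> by simp
next
  case (sym i l)
  then show ?case by (simp add: add.commute)
qed

section \<open>Bicentrally balanced labelings\<close>

definition magic_rectangles :: "nat \<Rightarrow> nat \<Rightarrow> (nat \<times> nat \<Rightarrow> 'a::ab_semigroup_add) \<Rightarrow> 'a \<Rightarrow> bool" where
  "magic_rectangles m n x c \<longleftrightarrow>
     (\<forall>i\<in>{1..m}. \<forall>i'\<in>{1..m}. \<forall>j\<in>{1..n}. \<forall>j'\<in>{1..n}. even i \<noteq> even i' \<longrightarrow> even j \<noteq> even j' \<longrightarrow>
       x (i, j) + x (i', j) + x (i, j') + x (i', j') = c)"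

lemma magic_rectangles_iff_squares:
  fixes x :: "nat \<times> nat \<Rightarrow> 'a::cancel_ab_semigroup_add"
  shows "magic_rectangles m n x c \<longleftrightarrow>
    (\<forall>i\<in>{1..m - 1}. \<forall>j\<in>{1..n - 1}.
      x (i, j) + x (i + 1, j) + x (i, j + 1) + x (i + 1, j + 1) = c)" (is "_ \<longleftrightarrow> ?squares")
proof
  assume ?squares
  have strip: "(x (i, l) + x (i, l + 1)) + (x (i', l) + x (i', l + 1)) = c"
    if l: "l \<in> {1..n - 1}" and i: "i \<in> {1..m}" "i' \<in> {1..m}" "even i \<noteq> even i'" for i i' l
  proof (rule consecutive_sums_eq_imp_sum_eq[of m "\<lambda>k. x (k, l) + x (k, l + 1)", OF _ i])
    show "(x (k, l) + x (k, l + 1)) + (x (k + 1, l) + x (k + 1, l + 1)) = c"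
      if "k \<in> {1..m - 1}" for k
      using \<open>?squares\<close>[rule_format, OF that l] by (simp add: add_ac)
  qed
  have "x (i, j) + x (i', j) + x (i, j') + x (i', j') = c"
    if i: "i \<in> {1..m}" "i' \<in> {1..m}" "even i \<noteq> even i'"
      and j: "j \<in> {1..n}" "j' \<in> {1..n}" "even j \<noteq> even j'" for i i' j j'
  proof -
    have "(x (i, l) + x (i', l)) + (x (i, l + 1) + x (i', l + 1)) = c" if "l \<in> {1..n - 1}" for l
      using strip[OF that i] by (simp add: add_ac)
    then have "(x (i, j) + x (i', j)) + (x (i, j') + x (i', j')) = c"
      by (rule consecutive_sums_eq_imp_sum_eq[of n "\<lambda>l. x (i, l) + x (i', l)", OF _ j])
    then show ?thesis by (simp only: add.assoc)
  qed
  then show "magic_rectangles m n x c"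
    unfolding magic_rectangles_def by blast
next
  assume rectangles: "magic_rectangles m n x c"
  show ?squares
  proof (intro ballI)
    fix i j assume "i \<in> {1..m - 1}" "j \<in> {1..n - 1}"
    then have "i \<in> {1..m}" "i + 1 \<in> {1..m}" "j \<in> {1..n}" "j + 1 \<in> {1..n}" by auto
    moreover have "even i \<noteq> even (i + 1)" "even j \<noteq> even (j + 1)" by simp_all
    ultimately show "x (i, j) + x (i + 1, j) + x (i, j + 1) + x (i + 1, j + 1) = c"
      using rectangles unfolding magic_rectangles_def by blast
  qed
qed

definition centrally_balanced :: "nat \<Rightarrow> nat \<Rightarrow> (nat \<times> nat \<Rightarrow> nat) \<Rightarrow> bool" where
  "centrally_balanced m n x \<longleftrightarrow>
     (\<forall>i\<in>{1..m}. \<forall>j\<in>{1..n}.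
        real (x (i, j)) + real (x (m + 1 - i, n + 1 - j)) = balance_sum m n i j)"

lemma centrally_balanced_antipodal_pairs_sum:
  assumes "centrally_balanced m n x"
    and "i \<in> {1..m}" "j \<in> {1..n}" "i' \<in> {1..m}" "j' \<in> {1..n}" "even (i + j) \<noteq> even (i' + j')"
  shows "x (i, j) + x (i', j') + x (m + 1 - i, n + 1 - j) + x (m + 1 - i', n + 1 - j')
    = 2 * m * n + 3"
proof -
  have "real (x (i, j)) + real (x (m + 1 - i, n + 1 - j)) = balance_sum m n i j"
    "real (x (i', j')) + real (x (m + 1 - i', n + 1 - j')) = balance_sum m n i' j'"
    using assms by (simp_all add: centrally_balanced_def)
  moreover have "balance_sum m n i j + balance_sum m n i' j' = real (2 * m * n + 3)"
    using assms(6) by (simp add: balance_sum_def)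
  ultimately have "real (x (i, j) + x (i', j') + x (m + 1 - i, n + 1 - j)
      + x (m + 1 - i', n + 1 - j')) = real (2 * m * n + 3)"
    by simp
  then show ?thesis by (simp only: of_nat_eq_iff)
qed

lemma ball_C4_faces_iff:
  "(\<forall>F\<in>C4_faces m n. P F) \<longleftrightarrow>
    (\<forall>i\<in>{1..m - 1}. \<forall>j\<in>{1..n - 1}. P {(i, j), (i + 1, j), (i, j + 1), (i + 1, j + 1)}) \<and>
    (\<forall>i\<in>{1..m - 1}. P {(i, n), (i + 1, n), (m + 1 - i, 1), (m - i, 1)}) \<and>
    (\<forall>j\<in>{1..n - 1}. P {(m, j), (m, j + 1), (1, n + 1 - j), (1, n - j)})"
  unfolding C4_faces_def by blast

text \<open>The faces that cross the boundary of the grid consist of two pairs of antipodal vertices,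
  so balance already gives their sums.\<close>

lemma centrally_balanced_imp_face_sums_iff:
  assumes "1 < m" "1 < n" and bal: "centrally_balanced m n x"
  shows "(\<forall>F\<in>C4_faces m n. sum x F = 2 * m * n + 3) \<longleftrightarrow> magic_rectangles m n x (2 * m * n + 3)"
proof -
  let ?c = "2 * m * n + 3"
  have square: "sum x {(i, j), (i + 1, j), (i, j + 1), (i + 1, j + 1)}
      = x (i, j) + x (i + 1, j) + x (i, j + 1) + x (i + 1, j + 1)" for i j
    by simp
  have column_wrap: "sum x {(i, n), (i + 1, n), (m + 1 - i, 1), (m - i, 1)} = ?c"
    if "i \<in> {1..m - 1}" for i
  proof -
    have "i \<in> {1..m}" "i + 1 \<in> {1..m}" "n \<in> {1..n}" "m + 1 - i \<noteq> m - i" "n \<noteq> 1"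
      using that assms by auto
    then show ?thesis
      using centrally_balanced_antipodal_pairs_sum[OF bal, of i n "i + 1" n] by simp
  qed
  have row_wrap: "sum x {(m, j), (m, j + 1), (1, n + 1 - j), (1, n - j)} = ?c"
    if "j \<in> {1..n - 1}" for j
  proof -
    have "j \<in> {1..n}" "j + 1 \<in> {1..n}" "m \<in> {1..m}" "n + 1 - j \<noteq> n - j" "m \<noteq> 1"
      using that assms by auto
    then show ?thesis
      using centrally_balanced_antipodal_pairs_sum[OF bal, of m j m "j + 1"] by simp
  qed
  show ?thesis
    unfolding ball_C4_faces_iff square magic_rectangles_iff_squares
    using column_wrap row_wrap by simp
qed

lemma bicentrally_balanced_iff:
  assumes "1 < m" "1 < n"
  shows "bicentrally_balanced m n x \<longleftrightarrow>
    x \<in> extensional (grid m n) \<and> bij_betw x (grid m n) {1..m * n} \<and>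
    magic_rectangles m n x (2 * m * n + 3) \<and> centrally_balanced m n x"
  unfolding bicentrally_balanced_def C4_face_magic_def centrally_balanced_def[symmetric]
  using centrally_balanced_imp_face_sums_iff[OF assms] by blast

lemma bicentrally_balanced_extensional:
  "bicentrally_balanced m n x \<Longrightarrow> x \<in> extensional (grid m n)"
  by (simp add: bicentrally_balanced_def C4_face_magic_def)

lemma bij_betw_relabel:
  assumes "\<sigma> permutes {1..m}" "\<tau> permutes {1..n}" "bij_betw x (grid m n) B"
  shows "bij_betw (relabel m n x \<sigma> \<tau>) (grid m n) B"
proof -
  have "bij_betw (map_prod \<sigma> \<tau>) (grid m n) (grid m n)"
    unfolding grid_def using assms(1,2) by (intro bij_betw_map_prod permutes_imp_bij)
  then have "bij_betw (x \<circ> map_prod \<sigma> \<tau>) (grid m n) B"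
    using assms(3) by (rule bij_betw_trans)
  then show ?thesis
    unfolding relabel_def by (simp cong: bij_betw_cong)
qed

lemma magic_rectangles_relabel:
  assumes "symmetric_perm m \<sigma>" "symmetric_perm n \<tau>" "magic_rectangles m n x c"
  shows "magic_rectangles m n (relabel m n x \<sigma> \<tau>) c"
  unfolding magic_rectangles_def
proof (intro ballI impI)
  fix i i' j j'
  assume i: "i \<in> {1..m}" "i' \<in> {1..m}" and j: "j \<in> {1..n}" "j' \<in> {1..n}"
    and "even i \<noteq> even i'" "even j \<noteq> even j'"
  then have "even (\<sigma> i) \<noteq> even (\<sigma> i')" "even (\<tau> j) \<noteq> even (\<tau> j')"
    using assms(1,2) by (simp_all add: symmetric_perm_def)
  moreover have "\<sigma> i \<in> {1..m}" "\<sigma> i' \<in> {1..m}" "\<tau> j \<in> {1..n}" "\<tau> j' \<in> {1..n}"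
    using i j symmetric_perm_in_iff[OF assms(1)] symmetric_perm_in_iff[OF assms(2)] by blast+
  ultimately have "x (\<sigma> i, \<tau> j) + x (\<sigma> i', \<tau> j) + x (\<sigma> i, \<tau> j') + x (\<sigma> i', \<tau> j') = c"
    using assms(3) unfolding magic_rectangles_def by blast
  then show "relabel m n x \<sigma> \<tau> (i, j) + relabel m n x \<sigma> \<tau> (i', j)
      + relabel m n x \<sigma> \<tau> (i, j') + relabel m n x \<sigma> \<tau> (i', j') = c"
    using i j by (simp only: relabel_apply)
qed

lemma centrally_balanced_relabel:
  assumes "symmetric_perm m \<sigma>" "symmetric_perm n \<tau>" "centrally_balanced m n x"
  shows "centrally_balanced m n (relabel m n x \<sigma> \<tau>)"
  unfolding centrally_balanced_def
proof (intro ballI)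
  fix i j assume i: "i \<in> {1..m}" and j: "j \<in> {1..n}"
  then have "m + 1 - i \<in> {1..m}" "n + 1 - j \<in> {1..n}" by auto
  then have "real (relabel m n x \<sigma> \<tau> (i, j)) + real (relabel m n x \<sigma> \<tau> (m + 1 - i, n + 1 - j))
      = real (x (\<sigma> i, \<tau> j)) + real (x (m + 1 - \<sigma> i, n + 1 - \<tau> j))"
    using i j symmetric_perm_minus[OF assms(1) i] symmetric_perm_minus[OF assms(2) j]
    by (simp add: relabel_apply)
  also have "\<dots> = balance_sum m n (\<sigma> i) (\<tau> j)"
    using assms(3) i j symmetric_perm_in_iff[OF assms(1)] symmetric_perm_in_iff[OF assms(2)]
    unfolding centrally_balanced_def by blast
  also have "\<dots> = balance_sum m n i j"
    using assms(1,2) by (simp add: balance_sum_def symmetric_perm_def)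
  finally show "real (relabel m n x \<sigma> \<tau> (i, j))
      + real (relabel m n x \<sigma> \<tau> (m + 1 - i, n + 1 - j)) = balance_sum m n i j" .
qed

lemma bicentrally_balanced_relabel:
  assumes "1 < m" "1 < n" "symmetric_perm m \<sigma>" "symmetric_perm n \<tau>" "bicentrally_balanced m n x"
  shows "bicentrally_balanced m n (relabel m n x \<sigma> \<tau>)"
proof -
  have "\<sigma> permutes {1..m}" "\<tau> permutes {1..n}"
    using assms(3,4) by (simp_all add: symmetric_perm_def)
  then show ?thesis
    using assms(3-5) unfolding bicentrally_balanced_iff[OF assms(1,2)]
    by (blast intro: relabel_extensional bij_betw_relabel magic_rectangles_relabel
        centrally_balanced_relabel)
qed

section \<open>Equivalence by relabeling\<close>

lemma rtranclp_elementary_op_relabel: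
  assumes "odd m" "odd n" "1 < m" "1 < n" and bal: "bicentrally_balanced m n x"
    and "symmetric_perm m \<sigma>" "symmetric_perm n \<tau>"
  shows "(elementary_op m n)\<^sup>*\<^sup>* x (relabel m n x \<sigma> \<tau>)"
proof -
  obtain \<rho> S where \<rho>: "symmetric_perm m \<rho>" "\<rho> ` {1..m div 2} \<subseteq> {1..m div 2}"
    and S: "S \<subseteq> {1..m div 2}" and \<sigma>: "\<sigma> = \<rho> \<circ> partial_reflect m S"
    using symmetric_perm_factor[OF assms(1,6)] .
  obtain \<pi> T where \<pi>: "symmetric_perm n \<pi>" "\<pi> ` {1..n div 2} \<subseteq> {1..n div 2}"
    and T: "T \<subseteq> {1..n div 2}" and \<tau>: "\<tau> = \<pi> \<circ> partial_reflect n T"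
    using symmetric_perm_factor[OF assms(2,7)] .
  note symmetric = \<rho>(1) \<pi>(1) symmetric_perm_id
    symmetric_perm_partial_reflect[OF assms(1)] symmetric_perm_partial_reflect[OF assms(2)]
  define u where "u = relabel m n x \<rho> id"
  define v where "v = relabel m n u (partial_reflect m S) id"
  define w where "w = relabel m n v id \<pi>"
  have z: "relabel m n x \<sigma> \<tau> = relabel m n w id (partial_reflect n T)"
    by (simp add: u_def v_def w_def \<sigma> \<tau> relabel_relabel symmetric)
  have "bicentrally_balanced m n u" "bicentrally_balanced m n v" "bicentrally_balanced m n w"
    unfolding u_def v_def w_def
    by (intro bicentrally_balanced_relabel assms(3,4) bal symmetric)+
  moreover have "column_perm_op m n x u"
    using column_perm_op_iff_relabel[OF assms(1)] u_def \<rho> by blast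
  moreover have "column_swap_op m n u v"
    using column_swap_op_iff_relabel[OF assms(1)] v_def S by blast
  moreover have "row_perm_op m n v w"
    using row_perm_op_iff_relabel[OF assms(2)] w_def \<pi> by blast
  moreover have "row_swap_op m n w (relabel m n x \<sigma> \<tau>)"
    using row_swap_op_iff_relabel[OF assms(2)] z T by blast
  ultimately have "elementary_op m n x u" "elementary_op m n u v" "elementary_op m n v w"
    "elementary_op m n w (relabel m n x \<sigma> \<tau>)"
    using bal by (simp_all add: elementary_op_def u_def v_def w_def)
  then show ?thesis by (meson converse_rtranclp_into_rtranclp r_into_rtranclp)
qed

lemma projective_labeling_equivalent_iff_symmetric_relabeling:
  assumes "odd m" "odd n" "1 < m" "1 < n" and bal: "bicentrally_balanced m n x"
  shows "projective_labeling_equivalent m n x z \<longleftrightarrow> symmetric_relabeling m n x z"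
proof
  note ops_imp = rtranclp_elementary_op_imp_symmetric_relabeling[OF assms(1,2)]
  assume "projective_labeling_equivalent m n x z"
  then have "(elementary_op m n)\<^sup>*\<^sup>* x z \<or> (elementary_op m n)\<^sup>*\<^sup>* z x"
    and "x \<in> extensional (grid m n)" "z \<in> extensional (grid m n)"
    by (auto simp: projective_labeling_equivalent_def bicentrally_balanced_extensional)
  then show "symmetric_relabeling m n x z"
    using ops_imp symmetric_relabeling_sym by blast
next
  assume "symmetric_relabeling m n x z"
  then obtain \<sigma> \<tau> where \<sigma>: "symmetric_perm m \<sigma>" and \<tau>: "symmetric_perm n \<tau>"
    and z: "z = relabel m n x \<sigma> \<tau>"
    unfolding symmetric_relabeling_def by blast
  have "(elementary_op m n)\<^sup>*\<^sup>* x z"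
    unfolding z using assms \<sigma> \<tau> by (intro rtranclp_elementary_op_relabel)
  moreover have "bicentrally_balanced m n z"
    unfolding z using assms \<sigma> \<tau> by (intro bicentrally_balanced_relabel)
  ultimately show "projective_labeling_equivalent m n x z"
    using bal by (simp add: projective_labeling_equivalent_def)
qed

section \<open>Alternating order on the central lines\<close>

definition alternating_sorted :: "nat \<Rightarrow> nat \<Rightarrow> (nat \<Rightarrow> nat) \<Rightarrow> bool" where
  "alternating_sorted m s f \<longleftrightarrow>
     (\<forall>i\<in>{1..m - 2}. even (i + s) \<longrightarrow> f i < f (i + 2)) \<and>
     (\<forall>i\<in>{1..m - 2}. odd (i + s) \<longrightarrow> f i > f (i + 2))"

definition signed_label :: "nat \<Rightarrow> (nat \<Rightarrow> nat) \<Rightarrow> nat \<Rightarrow> real" where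
  "signed_label s f i = (if even (i + s) then real (f i) else - real (f i))"

lemma signed_label_comp:
  "symmetric_perm m \<sigma> \<Longrightarrow> signed_label s (f \<circ> \<sigma>) = signed_label s f \<circ> \<sigma>"
  by (simp add: fun_eq_iff signed_label_def symmetric_perm_def)

lemma alternating_sorted_iff_strict_mono_on:
  "alternating_sorted m s f \<longleftrightarrow> (\<forall>p. strict_mono_on (fibre even {1..m} p) (signed_label s f))"
proof -
  have "signed_label s f i < signed_label s f (i + 2) \<longleftrightarrow>
      (even (i + s) \<longrightarrow> f i < f (i + 2)) \<and> (odd (i + s) \<longrightarrow> f i > f (i + 2))" for i
    by (simp add: signed_label_def)
  then have "alternating_sorted m s f \<longleftrightarrow>
      (\<forall>i\<in>{1..m - 2}. signed_label s f i < signed_label s f (i + 2))"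
    unfolding alternating_sorted_def by blast
  also have "\<dots> \<longleftrightarrow> (\<forall>p. strict_mono_on (fibre even {1..m} p) (signed_label s f))"
  proof
    assume step: "\<forall>i\<in>{1..m - 2}. signed_label s f i < signed_label s f (i + 2)"
    have "signed_label s f i < signed_label s f l"
      if "1 \<le> i" "i < l" "l \<le> m" "even i = even l" for i l
      by (rule transp_imp_rel_same_parity[of "(<)" m "signed_label s f", OF _ _ that])
        (use step in simp_all)
    then show "\<forall>p. strict_mono_on (fibre even {1..m} p) (signed_label s f)"
      by (auto simp: monotone_on_def fibre_def)
  next
    assume mono: "\<forall>p. strict_mono_on (fibre even {1..m} p) (signed_label s f)"
    show "\<forall>i\<in>{1..m - 2}. signed_label s f i < signed_label s f (i + 2)"
    proof
      fix i assume "i \<in> {1..m - 2}"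
      then have "i \<in> fibre even {1..m} (even i)" "i + 2 \<in> fibre even {1..m} (even i)"
        by (auto simp: fibre_def)
      then show "signed_label s f i < signed_label s f (i + 2)"
        using mono by (simp add: monotone_on_def)
    qed
  qed
  finally show ?thesis .
qed

lemma alternating_sorted_cong:
  assumes "\<And>i. i \<in> {1..m} \<Longrightarrow> f i = h i"
  shows "alternating_sorted m s f \<longleftrightarrow> alternating_sorted m s h"
proof -
  have "f i = h i" "f (i + 2) = h (i + 2)" if "i \<in> {1..m - 2}" for i
    by (rule assms; use that in auto)+
  then show ?thesis unfolding alternating_sorted_def by simp
qed

lemma fibrewise_sorts_imp_symmetric_perm:
  fixes g :: "nat \<Rightarrow> 'a::linorder"
  assumes "odd m" and inj: "\<And>p. inj_on g (fibre even {1..m} p)"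
    and reversed: "\<And>i l. i \<in> {1..m} \<Longrightarrow> l \<in> {1..m} \<Longrightarrow> even i = even l \<Longrightarrow> g i < g l \<Longrightarrow>
      g (m + 1 - l) < g (m + 1 - i)"
    and \<sigma>: "fibrewise_sorts even {1..m} g \<sigma>"
  shows "symmetric_perm m \<sigma>"
proof -
  have "fibrewise_sorts even {1..m} g (reflect m \<circ> \<sigma> \<circ> reflect m)"
  proof (rule fibrewise_sorts_conjugate[OF reflect_permutes even_reflect[OF assms(1)] _ _ \<sigma>])
    show "strict_antimono_on (fibre even {1..m} p) (reflect m)" for p
      by (auto simp: monotone_on_def fibre_def)
    show "g (reflect m l) < g (reflect m i)"
      if "i \<in> {1..m}" "l \<in> {1..m}" "even i = even l" "g i < g l" for i l
      unfolding reflect_eq[OF that(1)] reflect_eq[OF that(2)] using that by (rule reversed)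
  qed
  then have "reflect m \<circ> \<sigma> \<circ> reflect m = \<sigma>"
    using inj \<sigma> by (intro fibrewise_sorts_unique) simp_all
  then have "\<sigma> (reflect m i) = reflect m (\<sigma> i)" for i
    by (metis comp_apply reflect_reflect)
  then show ?thesis
    using \<sigma> by (simp add: fibrewise_sorts_def symmetric_perm_def)
qed

lemma ex1_alternating_sorted:
  assumes "odd m" and inj: "inj_on f {1..m}"
    and balance: "\<And>i l. i \<in> {1..m} \<Longrightarrow> l \<in> {1..m} \<Longrightarrow> even i = even l \<Longrightarrow>
      f i + f (m + 1 - i) = f l + f (m + 1 - l)"
  shows "\<exists>!\<sigma>. symmetric_perm m \<sigma> \<and> alternating_sorted m s (f \<circ> \<sigma>)"
proof -
  let ?g = "signed_label s f"
  have g_inj: "inj_on ?g (fibre even {1..m} p)" for p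
  proof (rule inj_onI)
    fix i l assume il: "i \<in> fibre even {1..m} p" "l \<in> fibre even {1..m} p" "?g i = ?g l"
    then have "f i = f l" by (simp add: fibre_def signed_label_def split: if_splits)
    then show "i = l" using il inj by (simp add: fibre_def inj_on_eq_iff)
  qed
  have g_reversed: "?g (m + 1 - l) < ?g (m + 1 - i)"
    if il: "i \<in> {1..m}" "l \<in> {1..m}" "even i = even l" and "?g i < ?g l" for i l
  proof -
    have "real (f i) + real (f (m + 1 - i)) = real (f l) + real (f (m + 1 - l))"
      using balance[OF il] by (metis of_nat_add)
    moreover have "even (m + 1 - i) = even i" "even (m + 1 - l) = even l"
      using il assms(1) by auto
    ultimately show ?thesis
      using \<open>?g i < ?g l\<close> il(3) by (simp add: signed_label_def split: if_splits)
  qed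
  have "fibrewise_sorts even {1..m} ?g \<sigma> \<longleftrightarrow> alternating_sorted m s (f \<circ> \<sigma>)"
    if \<sigma>: "symmetric_perm m \<sigma>" for \<sigma>
    unfolding alternating_sorted_iff_strict_mono_on signed_label_comp[OF \<sigma>]
    using \<sigma> by (simp add: fibrewise_sorts_def symmetric_perm_def)
  then have "fibrewise_sorts even {1..m} ?g \<sigma> \<longleftrightarrow>
      symmetric_perm m \<sigma> \<and> alternating_sorted m s (f \<circ> \<sigma>)" for \<sigma>
    using fibrewise_sorts_imp_symmetric_perm[OF assms(1) g_inj g_reversed] by blast
  then show ?thesis
    using ex1_fibrewise_sorts[OF _ g_inj] by simp
qed

lemma ex1_alternating_sorted_central_column:
  assumes "odd m" "odd n" and inj: "inj_on x (grid m n)" and bal: "centrally_balanced m n x"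
  shows "\<exists>!\<sigma>. symmetric_perm m \<sigma> \<and> alternating_sorted m s ((\<lambda>i. x (i, n div 2 + 1)) \<circ> \<sigma>)"
proof (rule ex1_alternating_sorted[OF assms(1)])
  let ?c = "n div 2 + 1"
  obtain k where "n = 2 * k + 1" using assms(2) by (rule oddE)
  then have c: "?c \<in> {1..n}" "n + 1 - ?c = ?c" by simp_all
  show "inj_on (\<lambda>i. x (i, ?c)) {1..m}"
  proof (rule inj_onI)
    fix i l assume "i \<in> {1..m}" "l \<in> {1..m}" "x (i, ?c) = x (l, ?c)"
    then show "i = l"
      using inj_onD[OF inj, of "(i, ?c)" "(l, ?c)"] c(1) by (simp add: grid_def)
  qed
  fix i l assume il: "i \<in> {1..m}" "l \<in> {1..m}" "even i = even l"
  have "real (x (k, ?c)) + real (x (m + 1 - k, ?c)) = balance_sum m n k ?c" if "k \<in> {1..m}" for k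
    using bal that c unfolding centrally_balanced_def by metis
  then have "real (x (i, ?c) + x (m + 1 - i, ?c)) = real (x (l, ?c) + x (m + 1 - l, ?c))"
    using il by (simp add: balance_sum_def)
  then show "x (i, ?c) + x (m + 1 - i, ?c) = x (l, ?c) + x (m + 1 - l, ?c)"
    by (simp only: of_nat_eq_iff)
qed

lemma ex1_alternating_sorted_central_row:
  assumes "odd m" "odd n" and inj: "inj_on x (grid m n)" and bal: "centrally_balanced m n x"
  shows "\<exists>!\<tau>. symmetric_perm n \<tau> \<and> alternating_sorted n s ((\<lambda>j. x (m div 2 + 1, j)) \<circ> \<tau>)"
proof -
  have "inj_on (x \<circ> prod.swap) (grid n m)"
    using inj by (intro comp_inj_on) (simp_all add: grid_def product_swap)
  moreover have "balance_sum n m j i = balance_sum m n i j" for i j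
    by (simp add: balance_sum_def add.commute mult.commute)
  then have "centrally_balanced n m (x \<circ> prod.swap)"
    using bal by (simp add: centrally_balanced_def)
  ultimately show ?thesis
    using ex1_alternating_sorted_central_column[OF assms(2,1), of "x \<circ> prod.swap" s] by simp
qed

definition centrally_sorted :: "nat \<Rightarrow> nat \<Rightarrow> (nat \<times> nat \<Rightarrow> nat) \<Rightarrow> bool" where
  "centrally_sorted m n z \<longleftrightarrow>
     alternating_sorted m (n div 2 + 1) (\<lambda>i. z (i, n div 2 + 1)) \<and>
     alternating_sorted n (m div 2 + 1) (\<lambda>j. z (m div 2 + 1, j))"

lemma centrally_sorted_relabel_iff:
  assumes "odd m" "odd n" "symmetric_perm m \<sigma>" "symmetric_perm n \<tau>"
  shows "centrally_sorted m n (relabel m n x \<sigma> \<tau>) \<longleftrightarrow>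
    alternating_sorted m (n div 2 + 1) ((\<lambda>i. x (i, n div 2 + 1)) \<circ> \<sigma>) \<and>
    alternating_sorted n (m div 2 + 1) ((\<lambda>j. x (m div 2 + 1, j)) \<circ> \<tau>)"
proof -
  have center: "m div 2 + 1 \<in> {1..m}" "n div 2 + 1 \<in> {1..n}"
    using assms(1,2) by (auto elim: oddE)
  have "alternating_sorted m (n div 2 + 1) (\<lambda>i. relabel m n x \<sigma> \<tau> (i, n div 2 + 1)) \<longleftrightarrow>
      alternating_sorted m (n div 2 + 1) ((\<lambda>i. x (i, n div 2 + 1)) \<circ> \<sigma>)"
    using center(2) symmetric_perm_center[OF assms(2,4)]
    by (intro alternating_sorted_cong) (simp add: relabel_apply)
  moreover have "alternating_sorted n (m div 2 + 1) (\<lambda>j. relabel m n x \<sigma> \<tau> (m div 2 + 1, j)) \<longleftrightarrow>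
      alternating_sorted n (m div 2 + 1) ((\<lambda>j. x (m div 2 + 1, j)) \<circ> \<tau>)"
    using center(1) symmetric_perm_center[OF assms(1,3)]
    by (intro alternating_sorted_cong) (simp add: relabel_apply)
  ultimately show ?thesis
    unfolding centrally_sorted_def by blast
qed

lemma ex1_equivalent_centrally_sorted:
  assumes "odd m" "odd n" "1 < m" "1 < n" and bal: "bicentrally_balanced m n x"
  shows "\<exists>!z. projective_labeling_equivalent m n x z \<and> centrally_sorted m n z"
proof -
  have inj: "inj_on x (grid m n)" and central: "centrally_balanced m n x"
    using bal by (simp_all add: bicentrally_balanced_iff[OF assms(3,4)] bij_betw_def)
  let ?column = "\<lambda>i. x (i, n div 2 + 1)" and ?row = "\<lambda>j. x (m div 2 + 1, j)"
  obtain \<sigma> where \<sigma>: "symmetric_perm m \<sigma>" "alternating_sorted m (n div 2 + 1) (?column \<circ> \<sigma>)"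
    and \<sigma>_unique: "\<And>\<sigma>'. symmetric_perm m \<sigma>' \<Longrightarrow>
      alternating_sorted m (n div 2 + 1) (?column \<circ> \<sigma>') \<Longrightarrow> \<sigma>' = \<sigma>"
    using ex1_alternating_sorted_central_column[OF assms(1,2) inj central] by metis
  obtain \<tau> where \<tau>: "symmetric_perm n \<tau>" "alternating_sorted n (m div 2 + 1) (?row \<circ> \<tau>)"
    and \<tau>_unique: "\<And>\<tau>'. symmetric_perm n \<tau>' \<Longrightarrow>
      alternating_sorted n (m div 2 + 1) (?row \<circ> \<tau>') \<Longrightarrow> \<tau>' = \<tau>"
    using ex1_alternating_sorted_central_row[OF assms(1,2) inj central] by metis
  note sorted_iff = centrally_sorted_relabel_iff[OF assms(1,2)]
  show ?thesis
    unfolding projective_labeling_equivalent_iff_symmetric_relabeling[OF assms]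
      symmetric_relabeling_def
  proof (intro ex1I[of _ "relabel m n x \<sigma> \<tau>"] conjI)
    show "centrally_sorted m n (relabel m n x \<sigma> \<tau>)"
      using sorted_iff \<sigma> \<tau> by blast
    show "z = relabel m n x \<sigma> \<tau>"
      if "(\<exists>\<sigma> \<tau>. symmetric_perm m \<sigma> \<and> symmetric_perm n \<tau> \<and> z = relabel m n x \<sigma> \<tau>) \<and>
        centrally_sorted m n z" for z
      using that sorted_iff \<sigma>_unique \<tau>_unique by blast
  qed (use \<sigma>(1) \<tau>(1) in blast)
qed

theorem theorem29:
  fixes m n m0 n0 :: nat and X :: "nat \<times> nat \<Rightarrow> nat"
  assumes "m \<ge> 3" and "n \<ge> 3" and "odd m" and "odd n"
    and "m = 2 * m0 + 1" and "n = 2 * n0 + 1"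
    and "bicentrally_balanced m n X"
  shows "\<exists>!Z. bicentrally_balanced m n Z \<and> projective_labeling_equivalent m n X Z \<and>
    (\<forall>i\<in>{1..m - 2}. even (i + (n0 + 1)) \<longrightarrow> Z (i, n0 + 1) < Z (i + 2, n0 + 1)) \<and>
    (\<forall>i\<in>{1..m - 2}. odd (i + (n0 + 1)) \<longrightarrow> Z (i, n0 + 1) > Z (i + 2, n0 + 1)) \<and>
    (\<forall>j\<in>{1..n - 2}. even (m0 + 1 + j) \<longrightarrow> Z (m0 + 1, j) < Z (m0 + 1, j + 2)) \<and>
    (\<forall>j\<in>{1..n - 2}. odd (m0 + 1 + j) \<longrightarrow> Z (m0 + 1, j) > Z (m0 + 1, j + 2))"
proof -
  have half: "m div 2 = m0" "n div 2 = n0" using assms(5,6) by simp_all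
  have "\<exists>!Z. projective_labeling_equivalent m n X Z \<and> centrally_sorted m n Z"
    using assms by (intro ex1_equivalent_centrally_sorted) simp_all
  moreover have "bicentrally_balanced m n Z" if "projective_labeling_equivalent m n X Z" for Z
    using that by (simp add: projective_labeling_equivalent_def)
  ultimately have "\<exists>!Z. bicentrally_balanced m n Z \<and> projective_labeling_equivalent m n X Z \<and>
      centrally_sorted m n Z"
    by metis
  then show ?thesis
    unfolding centrally_sorted_def alternating_sorted_def half
      add.commute[of _ "m0 + 1"] conj_assoc .
qed

end
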